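(* Let $a,b,c$ be real numbers with $0<a<1<b\le c<\min\{a+b,\,1+a+b-ab\}$. Then the order of convexity of the shifted hypergeometric function $z\,{}_2F_1(a,b;c;z)$ is $$\frac{c^2-a^2-b^2+3(a+b-c)-2}{2(a+b-c)}.$$
   Context: $\mathbb D=\{z\in\mathbb C:|z|<1\}$. For real $a,b,c$ with $c\ne 0,-1,-2,\dots$, ${}_2F_1(a,b;c;z)=\sum_{n=0}^\infty \frac{(a)_n(b)_n}{(c)_n n!}z^n$ for $z\in\mathbb D$, where $(a)_0=1$ and $(a)_n=a(a+1)\cdots(a+n-1)$. For $f$ analytic in $\mathbb D$ with $f(0)=0$, $f'(0)=1$, the order of convexity of $f$ is $\kappa(f)=1+\inf_{z\in\mathbb D}\operatorname{Re}\frac{zf''(z)}{f'(z)}\in[-\infty,1]$; it is regarded as not defined if $f'$ has zeros in $\mathbb D$. *)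

theory Defs
  imports "HOL-Analysis.Analysis"
begin

text \<open>
  The Gauss hypergeometric series with real parameters. It is meant for \<open>norm z < 1\<close> and
  \<open>c \<notin> \<int>\<^sub>\<le>\<^sub>0\<close>; elsewhere it is an unspecified or junk value.
\<close>
definition hypergeo_2F1 :: "real \<Rightarrow> real \<Rightarrow> real \<Rightarrow> complex \<Rightarrow> complex" where
  "hypergeo_2F1 a b c z =
     (\<Sum>n. of_real (pochhammer a n * pochhammer b n / (pochhammer c n * fact n)) * z ^ n)"

lemma hypergeo_2F1_eq_eval_fps:
  "hypergeo_2F1 a b c z = eval_fps (fps_hypergeo [of_real a, of_real b] [of_real c] 1) z"
  by (simp add: hypergeo_2F1_def eval_fps_def pochhammer_of_real)

text \<open>
  The order of convexity takes values in the extended reals since the infimum may be \<open>-\<infinity>\<close>.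
  It is only meaningful for normalized analytic functions on the unit disc with
  zero-free derivative; as HOL functions are total, this is expressed by a separate predicate.
\<close>
definition order_of_convexity_defined :: "(complex \<Rightarrow> complex) \<Rightarrow> bool" where
  "order_of_convexity_defined f \<longleftrightarrow>
     f analytic_on ball 0 1 \<and> f 0 = 0 \<and> deriv f 0 = 1 \<and> (\<forall>z\<in>ball 0 1. deriv f z \<noteq> 0)"

definition order_of_convexity :: "(complex \<Rightarrow> complex) \<Rightarrow> ereal" where
  "order_of_convexity f =
     1 + (INF z\<in>ball 0 1. ereal (Re (z * deriv (deriv f) z / deriv f z)))"

end

theory Submission
  imports Defs
begin

text \<open>
  Write \<open>f z = z * hypergeo_2F1 a b c z\<close> and \<open>s = a + b - c\<close>, so that \<open>0 < s < 1\<close>. Near \<open>1\<close> the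
  derivative \<open>f'\<close> grows like \<open>(1 - z) powr - (1 + s)\<close>, and the proof rests on a sign property of
  the function
  \<open>g z = (1 - z) powr (1 + s) * f' z\<close>
  obtained by removing this growth. Euler's transformation (\<open>fps_hypergeo_Euler\<close>) expresses \<open>g\<close>
  through the coefficients of \<open>hypergeo_2F1 (c - a) (c - b) c\<close>, and a short computation then gives
  \<open>g z = 1 - (\<Sum>n. d n * z ^ Suc n)\<close> with \<open>d n \<ge> 0\<close> (\<open>regularized_deriv\<close>, \<open>d_nonneg\<close>). The conditions on
  \<open>a, b, c\<close> are used for this sign.

  All the rest follows from the sign. The series for \<open>g\<close> and for \<open>h = - g'\<close> converge absolutely on
  the closed disc, with \<open>g 1 > 0\<close>. Therefore \<open>\<bar>g z\<bar> \<ge> g 1\<close>, which shows that \<open>f'\<close> has no zeros, and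
  \<open>\<bar>h z\<bar> \<le> h 1\<close>. Taking the logarithmic derivative of \<open>g\<close>,
  \<open>z * f'' z / f' z = (1 + s) * (z / (1 - z)) - z * h z / g z\<close>.
  The first term has real part at least \<open>- (1 + s) / 2\<close>, the second has modulus at most \<open>h 1 / g 1\<close>
  (\<open>Re_q_ge\<close>). Both bounds are approached at once when \<open>z\<close> tends to \<open>1\<close> tangentially to the circle
  (\<open>q_tangential_limit\<close>), so the order of convexity is \<open>1 - (1 + s) / 2 - h 1 / g 1\<close>.
  Finally, \<open>g 1\<close> and \<open>h 1\<close> turn out, by telescoping, to be multiples of one and the same positive
  number, with factors \<open>s\<close> and \<open>1 - s - (c - a) * (c - b)\<close>; their quotient yields the stated value.
\<close>

section \<open>Euler's transformation of hypergeometric series\<close>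

lemma fps_hypergeo_2F1_Suc:
  fixes a b c :: "'a :: field_char_0"
  assumes "c + of_nat n \<noteq> 0"
  shows "(of_nat n + 1) * (c + of_nat n) * fps_nth (fps_hypergeo [a, b] [c] 1) (Suc n)
         = (a + of_nat n) * (b + of_nat n) * fps_nth (fps_hypergeo [a, b] [c] 1) n"
proof -
  have "of_nat n + 1 \<noteq> (0::'a)" using of_nat_neq_0[of n, where 'a = 'a] by (simp add: add.commute)
  with assms have "(of_nat n + 1) * (c + of_nat n) \<noteq> 0" by simp
  moreover have "fps_nth (fps_hypergeo [a, b] [c] 1) (Suc n)
      = (a + of_nat n) * (b + of_nat n) / ((of_nat n + 1) * (c + of_nat n)) * fps_nth (fps_hypergeo [a, b] [c] 1) n"
    unfolding fps_hypergeo_rec by (simp add: add.commute del: fps_hypergeo_nth)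
  ultimately show ?thesis by (simp del: fps_hypergeo_nth)
qed

text \<open>
  The left-hand side is the hypergeometric differential operator applied to \<open>H\<close>; on coefficients
  it is a two-term recurrence, whose solution with \<open>H $ 0 = 1\<close> is unique.
\<close>
lemma fps_hypergeo_unique:
  fixes a b c :: "'a :: field_char_0"
  assumes ode: "fps_X * (1 - fps_X) * fps_deriv (fps_deriv H)
                + (fps_const c - fps_const (a + b + 1) * fps_X) * fps_deriv H
                - fps_const (a * b) * H = 0"
    and c: "\<And>n. c + of_nat n \<noteq> 0" and "fps_nth H 0 = 1"
  shows "H = fps_hypergeo [a, b] [c] 1"
proof (rule fps_ext)
  fix n
  have rec: "(of_nat n + 1) * (c + of_nat n) * fps_nth H (Suc n)
             = (a + of_nat n) * (b + of_nat n) * fps_nth H n" for n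
  proof -
    have "fps_nth (fps_X * fps_deriv (fps_deriv H) - fps_X * (fps_X * fps_deriv (fps_deriv H))
            + (fps_const c * fps_deriv H - fps_const (a + b + 1) * (fps_X * fps_deriv H))
            - fps_const (a * b) * H) n = 0"
      using ode by (simp add: algebra_simps)
    then show ?thesis
      by (cases n; cases "n - 1") (auto simp: algebra_simps)
  qed
  show "fps_nth H n = fps_nth (fps_hypergeo [a, b] [c] 1) n"
  proof (induction n)
    case (Suc n)
    define K where "K = (of_nat n + 1) * (c + of_nat n)"
    have "K \<noteq> 0"
      using of_nat_neq_0[of n, where 'a = 'a] c[of n] by (simp add: K_def add.commute)
    have "K * fps_nth H (Suc n) = K * fps_nth (fps_hypergeo [a, b] [c] 1) (Suc n)"
      unfolding K_def rec fps_hypergeo_2F1_Suc[OF c] Suc ..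
    with \<open>K \<noteq> 0\<close> show ?case by (simp del: fps_hypergeo_nth)
  qed (use assms in simp)
qed

lemma fps_hypergeo_ode:
  fixes a b c :: "'a :: field_char_0"
  assumes c: "\<And>n. c + of_nat n \<noteq> 0"
  defines "H \<equiv> fps_hypergeo [a, b] [c] 1"
  shows "fps_X * (1 - fps_X) * fps_deriv (fps_deriv H)
         + (fps_const c - fps_const (a + b + 1) * fps_X) * fps_deriv H
         - fps_const (a * b) * H = 0"
proof -
  have rec: "(of_nat n + 1) * (c + of_nat n) * fps_nth H (Suc n)
             = (a + of_nat n) * (b + of_nat n) * fps_nth H n" for n
    unfolding H_def by (rule fps_hypergeo_2F1_Suc[OF c])
  have "fps_nth (fps_X * fps_deriv (fps_deriv H) - fps_X * (fps_X * fps_deriv (fps_deriv H))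
          + (fps_const c * fps_deriv H - fps_const (a + b + 1) * (fps_X * fps_deriv H))
          - fps_const (a * b) * H) n = 0" for n
    using rec[of n] by (cases n; cases "n - 1") (auto simp: algebra_simps)
  then show ?thesis by (simp add: fps_eq_iff algebra_simps)
qed

text \<open>The series \<open>fps_hypergeo [- s] [] 1\<close> is the binomial series of \<open>(1 - z) powr s\<close>.\<close>
lemma fps_hypergeo_binomial_deriv:
  fixes s :: "'a :: field_char_0"
  defines "E \<equiv> fps_hypergeo [- s] [] 1"
  shows "(1 - fps_X) * fps_deriv E = - (fps_const s * E)"
proof -
  have rec: "(of_nat n + 1) * fps_nth E (Suc n) = (of_nat n - s) * fps_nth E n" for n
  proof -
    have "of_nat n + 1 \<noteq> (0::'a)" using of_nat_neq_0[of n, where 'a = 'a] by (simp add: add.commute)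
    then show ?thesis
      unfolding E_def fps_hypergeo_rec by (simp add: field_simps del: fps_hypergeo_nth)
  qed
  have "fps_nth (fps_deriv E - fps_X * fps_deriv E) n = fps_nth (- (fps_const s * E)) n" for n
    using rec[of n] by (cases n) (auto simp: algebra_simps)
  then show ?thesis by (simp add: fps_eq_iff left_diff_distrib)
qed

text \<open>
  If \<open>F\<close> solves the hypergeometric equation with parameters \<open>a, b, c\<close>, then \<open>F * E\<close>, where
  \<open>E\<close> is the binomial series with exponent \<open>a + b - c\<close>, solves the one with parameters
  \<open>c - a, c - b, c\<close>: the choice of the exponent is what makes the terms in \<open>fps_deriv F\<close> cancel.
\<close>
theorem fps_hypergeo_Euler:
  fixes a b c :: "'a :: field_char_0"
  assumes c: "\<And>n. c + of_nat n \<noteq> 0"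
  shows "fps_hypergeo [a, b] [c] 1 * fps_hypergeo [- (a + b - c)] [] 1
         = fps_hypergeo [c - a, c - b] [c] 1"
proof (rule fps_hypergeo_unique)
  define F E where "F = fps_hypergeo [a, b] [c] 1" and "E = fps_hypergeo [- (a + b - c)] [] (1::'a)"
  define X A B C :: "'a fps" where "X = fps_X" and "A = fps_const a" and "B = fps_const b" and "C = fps_const c"
  define F1 F2 E1 E2 where "F1 = fps_deriv F" and "F2 = fps_deriv F1"
    and "E1 = fps_deriv E" and "E2 = fps_deriv E1"
  have F: "X * (1 - X) * F2 + (C - (A + B + 1) * X) * F1 - A * B * F = 0"
    using fps_hypergeo_ode[OF c, of a b] unfolding F1_def F2_def F_def X_def A_def B_def C_def
    by (simp flip: fps_const_add fps_const_mult)
  have E1: "(1 - X) * E1 + (A + B - C) * E = 0"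
    using fps_hypergeo_binomial_deriv[of "a + b - c"]
    unfolding E_def E1_def X_def A_def B_def C_def
    by (simp flip: fps_const_add fps_const_sub)
  have "fps_deriv ((1 - X) * E1 + (A + B - C) * E) = 0" by (simp add: E1)
  then have E2: "(1 - X) * E2 - E1 + (A + B - C) * E1 = 0"
    unfolding A_def B_def C_def X_def E2_def E1_def by (simp add: algebra_simps)
  have "fps_X * (1 - fps_X) * fps_deriv (fps_deriv (F * E))
          + (fps_const c - fps_const (c - a + (c - b) + 1) * fps_X) * fps_deriv (F * E)
          - fps_const ((c - a) * (c - b)) * (F * E)
        = X * (1 - X) * (F2 * E + (F1 * E1 + F1 * E1) + F * E2)
          + (C - (C - A + (C - B) + 1) * X) * (F1 * E + F * E1) - (C - A) * (C - B) * (F * E)"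
    unfolding F1_def F2_def E1_def E2_def X_def A_def B_def C_def
    by (simp add: algebra_simps flip: fps_const_add fps_const_sub fps_const_mult)
       (simp add: numeral_fps_const)
  also have "\<dots> = E * (X * (1 - X) * F2 + (C - (A + B + 1) * X) * F1 - A * B * F)
          + (2 * X * F1 + C * F) * ((1 - X) * E1 + (A + B - C) * E)
          + X * F * ((1 - X) * E2 - E1 + (A + B - C) * E1)"
    by algebra
  also have "\<dots> = 0" by (simp only: F E1 E2) simp
  finally show "fps_X * (1 - fps_X) * fps_deriv (fps_deriv (F * E))
          + (fps_const c - fps_const (c - a + (c - b) + 1) * fps_X) * fps_deriv (F * E)
          - fps_const ((c - a) * (c - b)) * (F * E) = 0" .
qed (use c in simp_all)

section \<open>Power series with bounded or summable coefficients\<close>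

lemma norm_less_radius: "norm z < 1 \<Longrightarrow> 1 \<le> r \<Longrightarrow> ereal (norm z) < r"
  by (meson ereal_less(3) less_le_trans)

lemma fps_conv_radius_ge_1:
  fixes f :: "'a :: {banach, real_normed_field} fps"
  assumes "\<And>n. norm (fps_nth f n) \<le> 1"
  shows "fps_conv_radius f \<ge> 1"
  unfolding fps_conv_radius_def
proof (rule conv_radius_geI_ex)
  fix r :: real assume r: "0 < r" "ereal r < 1"
  have "summable (\<lambda>n. fps_nth f n * of_real r ^ n)"
  proof (rule summable_comparison_test')
    show "summable (\<lambda>n. r ^ n)" using r by (intro summable_geometric) auto
    show "norm (fps_nth f n * of_real r ^ n) \<le> r ^ n" for n
      using assms[of n] r by (simp add: norm_mult norm_power mult_left_le_one_le)
  qed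
  then show "\<exists>z. norm z = r \<and> summable (\<lambda>n. fps_nth f n * z ^ n)"
    using r by (intro exI[of _ "of_real r"]) auto
qed

context
  fixes u :: "nat \<Rightarrow> real" and P :: "complex fps"
  assumes nonneg: "\<And>n. 0 \<le> u n" and summable: "summable u"
    and P: "P = Abs_fps (\<lambda>n. of_real (u n))"
begin

lemma norm_summable_term_le: "norm z \<le> 1 \<Longrightarrow> norm (fps_nth P n * z ^ n) \<le> u n"
  using nonneg[of n] by (simp add: P norm_mult norm_power mult_left_le power_le_one)

lemma fps_conv_radius_summable: "fps_conv_radius P \<ge> 1"
proof -
  have "summable (\<lambda>n. fps_nth P n * 1 ^ n)"
    by (rule summable_comparison_test'[OF summable]) (use norm_summable_term_le[of 1] in auto)
  from conv_radius_geI[OF this] show ?thesis by (simp add: fps_conv_radius_def one_ereal_def)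
qed

lemma norm_eval_fps_summable_le:
  assumes "norm z \<le> 1"
  shows "norm (eval_fps P z) \<le> suminf u"
proof -
  have *: "summable (\<lambda>n. norm (fps_nth P n * z ^ n))"
    by (rule summable_comparison_test'[OF summable]) (use norm_summable_term_le[OF assms] in auto)
  have "norm (eval_fps P z) \<le> (\<Sum>n. norm (fps_nth P n * z ^ n))"
    unfolding eval_fps_def by (rule summable_norm[OF *])
  also have "\<dots> \<le> suminf u"
    by (intro suminf_le * summable norm_summable_term_le assms)
  finally show ?thesis .
qed

lemma eval_fps_summable_1: "eval_fps P 1 = of_real (suminf u)"
  by (simp add: eval_fps_def P suminf_of_real[OF summable])

lemma continuous_on_eval_fps_summable: "continuous_on (cball 0 1) (eval_fps P)"
proof -
  have "uniform_limit (cball 0 1) (\<lambda>n z. \<Sum>i<n. fps_nth P i * z ^ i)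
          (\<lambda>z. \<Sum>i. fps_nth P i * z ^ i) sequentially"
    by (rule Weierstrass_m_test[OF _ summable]) (use norm_summable_term_le in auto)
  then have "continuous_on (cball 0 1) (\<lambda>z. \<Sum>i. fps_nth P i * z ^ i)"
    by (rule uniform_limit_theorem[rotated]) (auto intro!: always_eventually continuous_intros)
  then show ?thesis by (simp add: eval_fps_def[abs_def])
qed

end

section \<open>The coefficients of the regularized derivative\<close>

locale convexity_range =
  fixes a b c :: real
  assumes a_pos: "0 < a" and a_less: "a < 1" and b_gt: "1 < b" and b_le: "b \<le> c"
    and c_less_sum: "c < a + b" and c_less: "c < 1 + a + b - a * b"
begin

definition s :: real where "s = a + b - c"

definition p :: real where "p = (c - a) * (c - b)"

text \<open>The coefficients of the factor that accompanies \<open>(1 - z) powr (- s)\<close> in Euler's transformation.\<close>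
definition G :: "nat \<Rightarrow> real" where
  "G n = fps_nth (fps_hypergeo [c - a, c - b] [c] 1) n"

text \<open>
  With \<open>f' = deriv (\<lambda>z. z * hypergeo_2F1 a b c z)\<close>, these numbers are the coefficients in
  \<open>(1 - z) powr (1 + s) * f' z = 1 - (\<Sum>n. d n * z ^ Suc n)\<close>.
\<close>
definition d :: "nat \<Rightarrow> real" where
  "d n = (real n + 1 - s) * G n - (real n + 2) * G (Suc n)"

lemma c_pos: "0 < c" and s_pos: "0 < s" and s_le: "s \<le> a" and s_gt: "a * b - 1 < s"
  using b_gt b_le c_less_sum c_less by (auto simp: s_def)

lemma G_0: "G 0 = 1"
  by (simp add: G_def)

lemma G_Suc: "(real n + 1) * (real n + c) * G (Suc n) = (real n + (c - a)) * (real n + (c - b)) * G n"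
  using fps_hypergeo_2F1_Suc[of c n "c - a" "c - b"] c_pos
  by (simp add: G_def add.commute del: fps_hypergeo_nth)

lemma rec_factor_pos: "0 < (real n + 1) * (real n + c)"
  using c_pos by (intro mult_pos_pos) auto

lemma G_nonneg: "0 \<le> G n"
proof (induction n)
  case (Suc n)
  have "0 \<le> (real n + 1) * (real n + c) * G (Suc n)"
    unfolding G_Suc using Suc a_less b_gt b_le by (intro mult_nonneg_nonneg) auto
  then show ?case by (metis rec_factor_pos leD zero_le_mult_iff)
qed (simp add: G_0)

text \<open>
  Inserting the recurrence for \<open>G\<close> leaves a polynomial of degree three in \<open>n\<close>, whose cubic and
  quadratic terms cancel.
\<close>
lemma d_eq: "(real n + 1) * (real n + c) * d n = ((1 + s - a * b) * real n + ((1 + s) * c - 2 * a * b)) * G n"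
proof -
  have "(real n + 1) * (real n + c) * d n
        = (real n + 1 - s) * (real n + 1) * (real n + c) * G n - (real n + 2) * ((real n + 1) * (real n + c) * G (Suc n))"
    by (simp add: d_def algebra_simps)
  moreover have "(real n + 1 - s) * (real n + 1) * (real n + c) - (real n + 2) * ((real n + (c - a)) * (real n + (c - b)))
        = (1 + s - a * b) * real n + ((1 + s) * c - 2 * a * b)"
    unfolding s_def by algebra
  ultimately show ?thesis unfolding G_Suc by (metis left_diff_distrib mult.assoc)
qed

lemma d_0_pos: "0 < (1 + s) * c - 2 * a * b"
proof (cases "a * b \<le> 1")
  case True
  have "(1 + s) * c - 2 * a * b = a * (1 - a * b) + b * (1 - a)\<^sup>2 + s * (c - 1)"
    by (simp add: s_def power2_eq_square algebra_simps)
  also have "\<dots> > 0"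
    using True a_pos a_less b_gt b_le s_pos by (intro add_nonneg_pos add_nonneg_nonneg mult_pos_pos) auto
  finally show ?thesis .
next
  case False
  \<comment> \<open>The expression is concave in \<open>s\<close>, and positive at both ends of \<open>{a * b - 1 .. a}\<close>.\<close>
  have "(a - (a * b - 1)) * ((1 + s) * c - 2 * a * b)
        = (a - s) * (a * b * ((1 - a) * (b - 1))) + (s - (a * b - 1)) * (b * (1 - a))
          + (a - (a * b - 1)) * (a - s) * (s - (a * b - 1))"
    by (simp add: s_def) algebra
  also have "\<dots> > 0"
    using False a_pos a_less b_gt s_gt s_le
    by (intro add_pos_nonneg add_nonneg_pos mult_pos_pos mult_nonneg_nonneg) auto
  finally show ?thesis
    using s_gt s_le by (simp add: zero_less_mult_iff)
qed

text \<open>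
  By \<open>d_eq\<close>, \<open>d n\<close> is a nonnegative multiple of a linear function of \<open>n\<close>. The slope \<open>1 + s - a * b\<close> is
  positive exactly because \<open>c < 1 + a + b - a * b\<close>, and the value at \<open>0\<close> is positive by \<open>d_0_pos\<close>.
\<close>
lemma d_nonneg: "0 \<le> d n"
proof -
  have "0 \<le> (real n + 1) * (real n + c) * d n"
    unfolding d_eq using s_gt d_0_pos G_nonneg
    by (intro mult_nonneg_nonneg add_nonneg_nonneg) auto
  then show ?thesis by (metis rec_factor_pos leD zero_le_mult_iff)
qed

lemma sum_d: "(\<Sum>k<n. d k) = 1 - ((real n + 1) * G n + s * (\<Sum>k<n. G k))"
  by (induction n) (simp_all add: G_0 d_def algebra_simps)

text \<open>
  Up to a multiple of \<open>G n\<close>, the coefficients of the derivative are differences of the null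
  sequence \<open>n * G n\<close>, so that their sum can be evaluated.
\<close>
lemma d_moment: "(real n + 1) * d n = (1 - s - p) * G n - (2 - c) * ((real n + 1) * G (Suc n) - real n * G n)"
proof -
  have "(real n + 1) * d n - ((1 - s - p) * G n - (2 - c) * ((real n + 1) * G (Suc n) - real n * G n))
        = ((real n + (c - a)) * (real n + (c - b))) * G n - (real n + 1) * (real n + c) * G (Suc n)"
    unfolding d_def s_def p_def by algebra
  then show ?thesis unfolding G_Suc by simp
qed

lemma sum_d_moment: "(\<Sum>k<n. (real k + 1) * d k) = (1 - s - p) * (\<Sum>k<n. G k) - (2 - c) * (real n * G n)"
  
proof (induction n)
  case (Suc n)
  then show ?case unfolding sum.lessThan_Suc d_moment by (simp add: algebra_simps)
qed simp

lemma summable_d: "summable d" and summable_G: "summable G"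
proof -
  have nonneg: "0 \<le> (real n + 1) * G n" "0 \<le> s * (\<Sum>k<n. G k)" "0 \<le> (\<Sum>k<n. d k)" for n
    using G_nonneg d_nonneg s_pos by (auto intro!: mult_nonneg_nonneg sum_nonneg)
  have "(\<Sum>k<n. d k) \<le> 1" for n
    unfolding sum_d using nonneg[of n] by linarith
  then show "summable d"
    by (intro bounded_imp_summable[where B = 1] d_nonneg) (metis lessThan_Suc_atMost)
  have "(\<Sum>k<n. G k) \<le> 1 / s" for n
    using sum_d[of n] nonneg[of n] s_pos by (simp add: field_simps)
  then show "summable G"
    by (intro bounded_imp_summable[where B = "1 / s"] G_nonneg) (metis lessThan_Suc_atMost)
qed

text \<open>
  The partial sums of \<open>d\<close> and \<open>G\<close> converge, hence so does \<open>n * G n\<close>; a positive limit would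
  make \<open>G\<close> dominate a harmonic series.
\<close>
lemma G_decay: "(\<lambda>n. (real n + 1) * G n) \<longlonglongrightarrow> 0"
proof -
  define L where "L = 1 - suminf d - s * suminf G"
  have "(\<lambda>n. 1 - (\<Sum>k<n. d k) - s * (\<Sum>k<n. G k)) \<longlonglongrightarrow> L"
    unfolding L_def by (intro tendsto_intros summable_LIMSEQ summable_d summable_G)
  then have L: "(\<lambda>n. (real n + 1) * G n) \<longlonglongrightarrow> L"
    by (simp add: sum_d)
  have "0 \<le> L"
    by (rule LIMSEQ_le_const[OF L]) (use G_nonneg in auto)
  moreover have "\<not> 0 < L"
  proof
    assume "0 < L"
    then have "\<forall>\<^sub>F n in sequentially. L / 2 < (real n + 1) * G n"
      by (intro order_tendstoD(1)[OF L]) auto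
    then have "\<forall>\<^sub>F n in sequentially. norm (L / 2 * inverse (real (Suc n))) \<le> G n"
      by eventually_elim (use \<open>0 < L\<close> in \<open>simp add: field_simps\<close>)
    then have "summable (\<lambda>n. L / 2 * inverse (real (Suc n)))"
      by (rule summable_comparison_test_ev[OF _ summable_G])
    then have "summable (\<lambda>n. inverse (real (Suc n)))"
      using \<open>0 < L\<close> by (subst (asm) summable_cmult_iff) auto
    then show False
      using not_summable_harmonic[where 'a = real] by (subst (asm) summable_Suc_iff) simp
  qed
  ultimately show ?thesis using L by simp
qed

lemma suminf_G_pos: "0 < suminf G"
  by (rule suminf_pos2[OF summable_G _ , of 0]) (use G_nonneg G_0 in auto)

lemma suminf_d: "suminf d = 1 - s * suminf G"
proof -
  have "(\<lambda>n. 1 - ((real n + 1) * G n + s * (\<Sum>k<n. G k))) \<longlonglongrightarrow> 1 - (0 + s * suminf G)"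
    by (intro tendsto_intros G_decay summable_LIMSEQ summable_G)
  then have "d sums (1 - s * suminf G)" by (simp add: sums_def sum_d)
  then show ?thesis by (rule sums_unique[symmetric])
qed

lemma d_moment_sums: "(\<lambda>n. (real n + 1) * d n) sums ((1 - s - p) * suminf G)"
proof -
  have "(\<lambda>n. (real n + 1) * G n - G n) \<longlonglongrightarrow> 0 - 0"
    by (intro tendsto_intros G_decay summable_LIMSEQ_zero summable_G)
  then have "(\<lambda>n. real n * G n) \<longlonglongrightarrow> 0" by (simp add: algebra_simps)
  then have "(\<lambda>n. (1 - s - p) * (\<Sum>k<n. G k) - (2 - c) * (real n * G n))
      \<longlonglongrightarrow> (1 - s - p) * suminf G - (2 - c) * 0"
    by (intro tendsto_intros summable_LIMSEQ summable_G)
  then show ?thesis by (simp add: sums_def sum_d_moment)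
qed

section \<open>The logarithmic derivative in the disc\<close>

definition F :: "complex fps" where "F = fps_hypergeo [of_real a, of_real b] [of_real c] 1"

definition E :: "complex fps" where "E = fps_hypergeo [- of_real s] [] 1"

definition f1 :: "complex fps" where "f1 = fps_deriv (fps_X * F)"

text \<open>
  \<open>1 - fps_X * V\<close> is the regularized derivative \<open>(1 - z) powr (1 + s) * f' z\<close>, and \<open>W\<close> is minus the
  derivative of that series.
\<close>
definition V :: "complex fps" where "V = Abs_fps (\<lambda>n. of_real (d n))"

definition W :: "complex fps" where "W = Abs_fps (\<lambda>n. of_real ((real n + 1) * d n))"

text \<open>
  Expanding \<open>f' = F + z * F'\<close> and replacing \<open>E * F'\<close> by \<open>(E * F)' - E' * F\<close> leaves an expression in
  the product \<open>F * E\<close> alone, whose coefficients \<open>G\<close> are known.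
\<close>
lemma regularized_deriv: "(1 - fps_X) * E * f1 = 1 - fps_X * V"
proof -
  define H where "H = Abs_fps (\<lambda>n. of_real (G n) :: complex)"
  have c: "of_real c + of_nat n \<noteq> (0 :: complex)" for n
    using c_pos by (metis add_pos_nonneg less_irrefl of_nat_0_le_iff of_real_add of_real_eq_0_iff of_real_of_nat_eq)
  have "H = fps_hypergeo [of_real c - of_real a, of_real c - of_real b] [of_real c] 1"
    by (rule fps_ext) (simp add: H_def G_def flip: pochhammer_of_real of_real_diff)
  then have FE: "F * E = H"
    using fps_hypergeo_Euler[OF c, of "of_real a" "of_real b"] by (simp add: F_def E_def s_def)
  have E1: "(1 - fps_X) * fps_deriv E = - (fps_const (of_real s) * E)"
    unfolding E_def by (rule fps_hypergeo_binomial_deriv)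
  have "(1 - fps_X) * E * f1 = (1 - fps_X) * (F * E) + fps_X * ((1 - fps_X) * fps_deriv (F * E) + fps_const (of_real s) * (F * E))
      - fps_X * F * ((1 - fps_X) * fps_deriv E + fps_const (of_real s) * E)"
    unfolding f1_def by (simp add: algebra_simps)
  also have "\<dots> = (1 - fps_X) * H + fps_X * ((1 - fps_X) * fps_deriv H + fps_const (of_real s) * H)"
    unfolding FE E1 by simp
  also have "\<dots> = H + fps_X * (fps_deriv H - fps_X * fps_deriv H + fps_const (of_real s) * H - H)"
    by (simp add: algebra_simps)
  also have "\<dots> = 1 - fps_X * V"
  proof (rule fps_ext)
    fix n
    show "fps_nth (H + fps_X * (fps_deriv H - fps_X * fps_deriv H + fps_const (of_real s) * H - H)) n
        = fps_nth (1 - fps_X * V) n"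
      by (cases n; cases "n - 1") (auto simp: H_def V_def d_def G_0 algebra_simps)
  qed
  finally show ?thesis .
qed

text \<open>The logarithmic derivative of \<open>regularized_deriv\<close>, cleared of denominators.\<close>
lemma regularized_deriv2:
  "(1 - fps_X) * fps_deriv f1 * (1 - fps_X * V)
   = f1 * ((1 + fps_const (of_real s)) * (1 - fps_X * V) - (1 - fps_X) * W)"
proof -
  have E1: "(1 - fps_X) * fps_deriv E = - (fps_const (of_real s) * E)"
    unfolding E_def by (rule fps_hypergeo_binomial_deriv)
  have W: "W = - fps_deriv (1 - fps_X * V)"
    by (rule fps_ext) (simp add: W_def V_def distrib_right)
  have W': "W = E * f1 - (1 - fps_X) * fps_deriv E * f1 - (1 - fps_X) * E * fps_deriv f1"
    unfolding W regularized_deriv[symmetric] by (simp add: algebra_simps)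
  show ?thesis
    unfolding W' E1 unfolding regularized_deriv[symmetric] by algebra
qed

lemma norm_E_le: "norm (fps_nth E n) \<le> 1"
proof (induction n)
  case (Suc n)
  have "fps_nth E (Suc n) = of_real ((real n - s) / (real n + 1)) * fps_nth E n"
    unfolding E_def fps_hypergeo_rec by (simp add: algebra_simps del: fps_hypergeo_nth)
  moreover have "\<bar>(real n - s) / (real n + 1)\<bar> \<le> 1"
    using s_pos s_le a_less by (simp add: abs_le_iff divide_simps)
  ultimately show ?case
    using Suc by (metis norm_mult norm_of_real mult_le_one norm_ge_zero)
qed (simp add: E_def)

lemma norm_F_le: "norm (fps_nth F n) \<le> 1"
proof (induction n)
  case (Suc n)
  have "fps_nth F (Suc n) = of_real ((real n + a) * (real n + b) / ((real n + 1) * (real n + c))) * fps_nth F n"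
    unfolding F_def fps_hypergeo_rec by (simp add: add.commute del: fps_hypergeo_nth)
  moreover have "(real n + a) * (real n + b) \<le> (real n + 1) * (real n + c)"
    using a_pos a_less b_gt b_le by (intro mult_mono) auto
  then have "\<bar>(real n + a) * (real n + b) / ((real n + 1) * (real n + c))\<bar> \<le> 1"
    using rec_factor_pos[of n] a_pos b_gt c_pos by (simp add: abs_mult abs_of_pos[of "real n + c"] add_nonneg_pos)
  ultimately show ?case
    using Suc by (metis norm_mult norm_of_real mult_le_one norm_ge_zero)
qed (simp add: F_def)

lemma conv_radii: "fps_conv_radius E \<ge> 1" "fps_conv_radius F \<ge> 1" "fps_conv_radius (fps_X * F) \<ge> 1"
  "fps_conv_radius f1 \<ge> 1" "fps_conv_radius (fps_deriv f1) \<ge> 1"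
proof -
  show "fps_conv_radius E \<ge> 1" by (rule fps_conv_radius_ge_1[OF norm_E_le])
  show F: "fps_conv_radius F \<ge> 1" by (rule fps_conv_radius_ge_1[OF norm_F_le])
  then show XF: "fps_conv_radius (fps_X * F) \<ge> 1"
    using fps_conv_radius_mult[of fps_X F] by simp
  show f1: "fps_conv_radius f1 \<ge> 1"
    unfolding f1_def by (rule order_trans[OF XF fps_conv_radius_deriv])
  show "fps_conv_radius (fps_deriv f1) \<ge> 1"
    by (rule order_trans[OF f1 fps_conv_radius_deriv])
qed

lemma moment_nonneg: "0 \<le> (real n + 1) * d n"
  using d_nonneg by simp

lemmas summable_moment = sums_summable[OF d_moment_sums]

lemma conv_radius_V: "fps_conv_radius V \<ge> 1" and conv_radius_W: "fps_conv_radius W \<ge> 1"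
  using fps_conv_radius_summable[OF d_nonneg summable_d V_def]
    fps_conv_radius_summable[OF moment_nonneg summable_moment W_def] by auto

text \<open>As \<open>d\<close> is nonnegative, the regularized derivative is smallest in modulus at the point \<open>1\<close>.\<close>
lemma norm_regularized_deriv_ge:
  assumes "norm z \<le> 1"
  shows "s * suminf G \<le> norm (1 - z * eval_fps V z)"
proof -
  have "norm (z * eval_fps V z) \<le> 1 * suminf d"
    unfolding norm_mult
    by (intro mult_mono norm_eval_fps_summable_le[OF d_nonneg summable_d V_def] assms) auto
  then have "1 - suminf d \<le> norm (1::complex) - norm (z * eval_fps V z)" by simp
  also have "\<dots> \<le> norm (1 - z * eval_fps V z)" by (rule norm_triangle_ineq2)
  finally show ?thesis by (simp add: suminf_d)
qed

lemma eval_disc: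
  assumes z: "norm z < 1"
  shows eval_f1: "(1 - z) * eval_fps E z * eval_fps f1 z = 1 - z * eval_fps V z"
    and eval_f2: "(1 - z) * eval_fps (fps_deriv f1) z * (1 - z * eval_fps V z)
         = eval_fps f1 z * ((1 + of_real s) * (1 - z * eval_fps V z) - (1 - z) * eval_fps W z)"
proof -
  note less = norm_less_radius[OF z]
  note radius = conv_radii conv_radius_V conv_radius_W
  note mult = fps_conv_radius_mult[THEN order_trans[rotated]]
  note diff = fps_conv_radius_diff[THEN order_trans[rotated]]
  note add = fps_conv_radius_add[THEN order_trans[rotated]]
  have X: "eval_fps (1 - fps_X) z = 1 - z"
    by (subst eval_fps_diff) auto
  have XV: "eval_fps (1 - fps_X * V) z = 1 - z * eval_fps V z"
    by (subst eval_fps_diff eval_fps_mult; (intro less radius mult)?; simp add: radius)+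
  have "eval_fps ((1 - fps_X) * E * f1) z = (1 - z) * eval_fps E z * eval_fps f1 z"
    by (simp add: eval_fps_mult less radius mult diff X)
  then show "(1 - z) * eval_fps E z * eval_fps f1 z = 1 - z * eval_fps V z"
    by (simp add: regularized_deriv XV)
  have "eval_fps ((1 - fps_X) * fps_deriv f1 * (1 - fps_X * V)) z
      = (1 - z) * eval_fps (fps_deriv f1) z * (1 - z * eval_fps V z)"
    by (simp add: eval_fps_mult less radius mult diff X XV)
  moreover have "eval_fps (f1 * ((1 + fps_const (of_real s)) * (1 - fps_X * V) - (1 - fps_X) * W)) z
      = eval_fps f1 z * ((1 + of_real s) * (1 - z * eval_fps V z) - (1 - z) * eval_fps W z)"
    by (simp add: eval_fps_mult eval_fps_diff eval_fps_add less radius mult diff add X XV)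
  ultimately show "(1 - z) * eval_fps (fps_deriv f1) z * (1 - z * eval_fps V z)
         = eval_fps f1 z * ((1 + of_real s) * (1 - z * eval_fps V z) - (1 - z) * eval_fps W z)"
    by (simp add: regularized_deriv2)
qed

lemma eval_f1_nonzero:
  assumes "norm z < 1"
  shows "eval_fps f1 z \<noteq> 0"
proof
  assume "eval_fps f1 z = 0"
  with eval_f1[OF assms] norm_regularized_deriv_ge[of z] assms have "s * suminf G \<le> 0" by simp
  then show False using s_pos suminf_G_pos by (simp add: mult_le_0_iff)
qed

definition q :: "complex \<Rightarrow> complex" where
  "q z = (1 + of_real s) * (z / (1 - z)) - z * eval_fps W z / (1 - z * eval_fps V z)"

lemma logarithmic_deriv:
  assumes "norm z < 1"
  shows "z * eval_fps (fps_deriv f1) z / eval_fps f1 z = q z"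
proof -
  have "1 - z * eval_fps V z \<noteq> 0"
    using norm_regularized_deriv_ge[of z] assms mult_pos_pos[OF s_pos suminf_G_pos] by auto
  moreover have "1 - z \<noteq> 0" using assms by auto
  ultimately show ?thesis
    using eval_f2[OF assms] eval_f1_nonzero[OF assms]
    by (simp add: q_def divide_simps) algebra
qed

lemma f_eq: "norm z < 1 \<Longrightarrow> z * hypergeo_2F1 a b c z = eval_fps (fps_X * F) z"
  unfolding hypergeo_2F1_eq_eval_fps F_def[symmetric]
  using conv_radii(2) by (subst eval_fps_mult) (auto intro: norm_less_radius)

lemma has_field_derivative_f:
  assumes z: "norm z < 1"
  shows "((\<lambda>z. z * hypergeo_2F1 a b c z) has_field_derivative eval_fps f1 z) (at z)"
proof (rule has_field_derivative_transform_within_open)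
  show "(eval_fps (fps_X * F) has_field_derivative eval_fps f1 z) (at z)"
    unfolding f1_def using conv_radii(3) z
    by (intro has_field_derivative_eval_fps) (auto intro: norm_less_radius)
  show "open (ball (0::complex) 1)" "z \<in> ball 0 1" using z by auto
qed (simp add: f_eq)

lemma deriv_f: "norm z < 1 \<Longrightarrow> deriv (\<lambda>z. z * hypergeo_2F1 a b c z) z = eval_fps f1 z"
  by (rule DERIV_imp_deriv[OF has_field_derivative_f])

lemma deriv2_f:
  assumes z: "norm z < 1"
  shows "deriv (deriv (\<lambda>z. z * hypergeo_2F1 a b c z)) z = eval_fps (fps_deriv f1) z"
proof (rule DERIV_imp_deriv, rule has_field_derivative_transform_within_open)
  show "(eval_fps f1 has_field_derivative eval_fps (fps_deriv f1) z) (at z)"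
    using conv_radii(4) z
    by (intro has_field_derivative_eval_fps) (auto intro: norm_less_radius)
  show "open (ball (0::complex) 1)" "z \<in> ball 0 1" using z by auto
qed (simp add: deriv_f)

section \<open>The order of convexity\<close>

lemma order_of_convexity_defined_f: "order_of_convexity_defined (\<lambda>z. z * hypergeo_2F1 a b c z)"
  unfolding order_of_convexity_defined_def
proof (intro conjI ballI)
  show "(\<lambda>z. z * hypergeo_2F1 a b c z) analytic_on ball 0 1"
    unfolding analytic_on_open[OF open_ball] holomorphic_on_open[OF open_ball]
    using has_field_derivative_f by (meson mem_ball_0)
  show "deriv (\<lambda>z. z * hypergeo_2F1 a b c z) 0 = 1"
    by (simp add: deriv_f eval_fps_at_0 f1_def F_def)
  show "deriv (\<lambda>z. z * hypergeo_2F1 a b c z) z \<noteq> 0" if "z \<in> ball 0 1" for z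
    using that by (simp add: deriv_f eval_f1_nonzero)
qed simp

lemma Re_moebius_ge:
  assumes "norm z < 1"
  shows "- 1 / 2 \<le> Re (z / (1 - z))"
proof -
  have "1 - z \<noteq> 0" using assms by auto
  have "(Re z)\<^sup>2 + (Im z)\<^sup>2 < 1"
    using assms by (simp add: norm_complex_def)
  moreover have "(1 - Re z)\<^sup>2 + (Im z)\<^sup>2 > 0"
    using \<open>1 - z \<noteq> 0\<close> by (simp add: complex_eq_iff sum_power2_gt_zero_iff)
  ultimately show ?thesis
    by (simp add: Re_divide field_simps power2_eq_square)
qed

text \<open>
  In the second term of \<open>q\<close>, nonnegativity of the coefficients makes the numerator largest and the
  denominator smallest at the point \<open>1\<close>, where the common factor \<open>suminf G\<close> cancels.
\<close>
lemma Re_q_ge: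
  assumes z: "norm z < 1"
  shows "(1 + s) * (- 1 / 2) - (1 - s - p) / s \<le> Re (q z)"
proof -
  have W: "norm (eval_fps W z) \<le> (1 - s - p) * suminf G"
    using norm_eval_fps_summable_le[OF moment_nonneg summable_moment W_def, of z] z
    by (simp add: sums_unique[OF d_moment_sums, symmetric])
  have "norm (z * eval_fps W z / (1 - z * eval_fps V z)) \<le> (1 * ((1 - s - p) * suminf G)) / (s * suminf G)"
    unfolding norm_divide norm_mult using z W norm_regularized_deriv_ge[of z] s_pos suminf_G_pos
    by (intro frac_le mult_mono) (auto intro: order_trans[OF norm_ge_zero])
  then have "norm (z * eval_fps W z / (1 - z * eval_fps V z)) \<le> (1 - s - p) / s"
    using suminf_G_pos by simp
  then have "Re (z * eval_fps W z / (1 - z * eval_fps V z)) \<le> (1 - s - p) / s"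
    using complex_Re_le_cmod order_trans by blast
  moreover have "(1 + s) * (- 1 / 2) \<le> (1 + s) * Re (z / (1 - z))"
    using s_pos by (intro mult_left_mono Re_moebius_ge z) auto
  moreover have "Re (q z) = (1 + s) * Re (z / (1 - z)) - Re (z * eval_fps W z / (1 - z * eval_fps V z))"
    unfolding q_def minus_complex.sel
    by (metis Re_complex_of_real Im_complex_of_real diff_zero mult_zero_left of_real_1 of_real_add times_complex.sel(1))
  ultimately show ?thesis by linarith
qed

text \<open>
  The map \<open>w \<mapsto> 1 - 1 / w\<close> sends the half-plane \<open>Re w > 1 / 2\<close> onto the disc and
  \<open>z / (1 - z) = w - 1\<close>. Letting \<open>w\<close> tend to infinity along points whose real part tends
  to \<open>1 / 2\<close> makes \<open>z\<close> approach \<open>1\<close> tangentially to the circle.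
\<close>
lemma q_tangential_limit:
  "\<exists>\<zeta>. (\<forall>n. norm (\<zeta> n) < 1) \<and> (\<lambda>n. Re (q (\<zeta> n))) \<longlonglongrightarrow> (1 + s) * (- 1 / 2) - (1 - s - p) / s"
proof -
  define w where "w = (\<lambda>n. Complex (1 / 2 + inverse (real (Suc n))) (real n))"
  define \<zeta> where "\<zeta> = (\<lambda>n. 1 - 1 / w n)"
  have w: "w n \<noteq> 0" for n
  proof -
    have "Re (w n) > 0" unfolding w_def by (simp add: add_pos_pos)
    then show ?thesis by auto
  qed
  have \<zeta>_less: "norm (\<zeta> n) < 1" for n
  proof -
    have "norm (w n - 1) < norm (w n)"
      unfolding w_def norm_complex_def
      by (rule real_sqrt_less_mono) (simp add: power2_eq_square algebra_simps)
    then show ?thesis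
      using w[of n] by (simp add: \<zeta>_def norm_divide divide_simps diff_divide_eq_iff)
  qed
  have "filterlim (\<lambda>n. norm (w n)) at_top sequentially"
  proof (rule filterlim_at_top_mono[OF filterlim_real_sequentially])
    show "\<forall>\<^sub>F n in sequentially. real n \<le> norm (w n)"
      by (intro always_eventually allI order_trans[OF _ abs_Im_le_cmod]) (simp add: w_def)
  qed
  then have "(\<lambda>n. inverse (w n)) \<longlonglongrightarrow> 0"
    by (intro tendsto_compose_filtermap tendsto_inverse_0[THEN filterlim_compose] filterlim_norm_at_top_imp_at_infinity)
  then have "(\<lambda>n. 1 - inverse (w n)) \<longlonglongrightarrow> 1 - 0"
    by (intro tendsto_intros)
  then have \<zeta>: "\<zeta> \<longlonglongrightarrow> 1"
    by (simp add: \<zeta>_def inverse_eq_divide)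
  have lim: "(\<lambda>n. h (\<zeta> n)) \<longlonglongrightarrow> h 1" if "continuous_on (cball 0 1) h" for h :: "complex \<Rightarrow> complex"
    using continuous_on_tendsto_compose[OF that \<zeta>] \<zeta>_less by (auto intro!: always_eventually less_imp_le)
  have V: "(\<lambda>n. eval_fps V (\<zeta> n)) \<longlonglongrightarrow> of_real (suminf d)"
    using lim[OF continuous_on_eval_fps_summable[OF d_nonneg summable_d V_def]]
    by (simp add: eval_fps_summable_1[OF d_nonneg summable_d V_def])
  have W: "(\<lambda>n. eval_fps W (\<zeta> n)) \<longlonglongrightarrow> of_real ((1 - s - p) * suminf G)"
    using lim[OF continuous_on_eval_fps_summable[OF moment_nonneg summable_moment W_def]]
    by (simp add: eval_fps_summable_1[OF moment_nonneg summable_moment W_def]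
          sums_unique[OF d_moment_sums, symmetric])
  have nz: "1 - 1 * of_real (suminf d) \<noteq> (0::complex)"
    using s_pos suminf_G_pos by (simp add: suminf_d)
  have "(\<lambda>n. Re (\<zeta> n * eval_fps W (\<zeta> n) / (1 - \<zeta> n * eval_fps V (\<zeta> n))))
      \<longlonglongrightarrow> Re (1 * of_real ((1 - s - p) * suminf G) / (1 - 1 * of_real (suminf d)))"
    by (intro tendsto_intros \<zeta> V W nz)
  also have "1 * of_real ((1 - s - p) * suminf G) / (1 - 1 * of_real (suminf d)) = complex_of_real ((1 - s - p) / s)"
    using suminf_G_pos by (simp add: suminf_d)
  finally have R: "(\<lambda>n. Re (\<zeta> n * eval_fps W (\<zeta> n) / (1 - \<zeta> n * eval_fps V (\<zeta> n)))) \<longlonglongrightarrow> (1 - s - p) / s"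
    by simp
  have "\<zeta> n / (1 - \<zeta> n) = w n - 1" for n
    using w[of n] by (simp add: \<zeta>_def field_simps)
  then have "Re (q (\<zeta> n)) = (1 + s) * (inverse (real (Suc n)) - 1 / 2)
      - Re (\<zeta> n * eval_fps W (\<zeta> n) / (1 - \<zeta> n * eval_fps V (\<zeta> n)))" for n
    by (simp add: q_def w_def)
  moreover have "(\<lambda>n. (1 + s) * (inverse (real (Suc n)) - 1 / 2)
      - Re (\<zeta> n * eval_fps W (\<zeta> n) / (1 - \<zeta> n * eval_fps V (\<zeta> n))))
      \<longlonglongrightarrow> (1 + s) * (0 - 1 / 2) - (1 - s - p) / s"
    by (intro tendsto_intros R LIMSEQ_inverse_real_of_nat)
  ultimately have "(\<lambda>n. Re (q (\<zeta> n))) \<longlonglongrightarrow> (1 + s) * (- 1 / 2) - (1 - s - p) / s"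
    by simp
  with \<zeta>_less show ?thesis by blast
qed

lemma order_of_convexity_f:
  "order_of_convexity (\<lambda>z. z * hypergeo_2F1 a b c z) = ereal (1 + ((1 + s) * (- 1 / 2) - (1 - s - p) / s))"
proof -
  define m where "m = (1 + s) * (- 1 / 2) - (1 - s - p) / s"
  obtain \<zeta> where \<zeta>: "\<And>n. norm (\<zeta> n) < 1" and lim: "(\<lambda>n. Re (q (\<zeta> n))) \<longlonglongrightarrow> m"
    using q_tangential_limit unfolding m_def by blast
  have "(INF z\<in>ball 0 1. ereal (Re (q z))) = ereal m"
  proof (rule antisym)
    have "(\<lambda>n. ereal (Re (q (\<zeta> n)))) \<longlonglongrightarrow> ereal m" using lim by simp
    then show "(INF z\<in>ball 0 1. ereal (Re (q z))) \<le> ereal m"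
      by (rule LIMSEQ_le_const) (use \<zeta> in \<open>auto intro!: INF_lower\<close>)
    show "ereal m \<le> (INF z\<in>ball 0 1. ereal (Re (q z)))"
      by (rule INF_greatest) (use Re_q_ge in \<open>simp add: m_def\<close>)
  qed
  moreover have "(INF z\<in>ball 0 1. ereal (Re (z * deriv (deriv (\<lambda>z. z * hypergeo_2F1 a b c z)) z
      / deriv (\<lambda>z. z * hypergeo_2F1 a b c z) z))) = (INF z\<in>ball 0 1. ereal (Re (q z)))"
    by (intro INF_cong refl) (simp add: deriv_f deriv2_f logarithmic_deriv)
  ultimately show ?thesis
    unfolding order_of_convexity_def m_def by (simp only: plus_ereal.simps(1) one_ereal_def)
qed

end

theorem corollary1p8:
  fixes a b c :: real
  assumes "0 < a" and "a < 1" and "1 < b" and "b \<le> c"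
    and "c < min (a + b) (1 + a + b - a * b)"
  shows "order_of_convexity_defined (\<lambda>z. z * hypergeo_2F1 a b c z) \<and>
         order_of_convexity (\<lambda>z. z * hypergeo_2F1 a b c z) =
           ereal ((c\<^sup>2 - a\<^sup>2 - b\<^sup>2 + 3 * (a + b - c) - 2) / (2 * (a + b - c)))"
proof -
  interpret convexity_range a b c
    using assms by unfold_locales auto
  have "1 + ((1 + s) * (- 1 / 2) - (1 - s - p) / s) = (s * (1 - s) - 2 * (1 - s - p)) / (2 * s)"
    using s_pos by (simp add: field_simps)
  also have "s * (1 - s) - 2 * (1 - s - p) = c\<^sup>2 - a\<^sup>2 - b\<^sup>2 + 3 * (a + b - c) - 2"
    by (simp add: s_def p_def power2_eq_square algebra_simps)
  finally show ?thesis
    using order_of_convexity_defined_f order_of_convexity_f by (simp add: s_def)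
qed

end
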